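(* Let $\mathbf{n}=(n_1,\ldots,n_d)\in\mathbb{N}^d$ have pairwise relatively prime entries. The functions $\chi^{(\mathbf{n})}_{\boldsymbol{\gamma}}$, $\boldsymbol{\gamma}\in\Gamma^{(\mathbf{n})}$, form an orthogonal basis of the inner product space $(\mathcal{L}(I^{(\mathbf{n})}),\langle\cdot,\cdot\rangle_{\omega^{(\mathbf{n})}})$. Further, the norms of the basis functions satisfy $$\|\chi^{(\mathbf{n})}_{\boldsymbol{\gamma}}\|^2_{\omega^{(\mathbf{n})}}=\begin{cases}2^{-\mathfrak{e}(\boldsymbol{\gamma})},&\text{if }\boldsymbol{\gamma}\in\Gamma^{(\mathbf{n})}\setminus\{(0,\ldots,0,n_d)\},\\ 1,&\text{if }\boldsymbol{\gamma}=(0,\ldots,0,n_d).\end{cases}$$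
   Context: $\mathbb{N}=\{1,2,\ldots\}$, $\mathbb{N}_0=\mathbb{N}\cup\{0\}$, $d\in\mathbb{N}$, $p[\mathbf{n}]=\prod_{j=1}^dn_j$. For $\mathfrak{r}\in\{0,1\}$ let $I^{(\mathbf{n})}_{\mathfrak{r}}$ be the set of all $\mathbf{i}\in\mathbb{N}_0^d$ with $0\le i_j\le n_j$ and $i_j\equiv\mathfrak{r}\bmod 2$ for all $j$, and $I^{(\mathbf{n})}=I^{(\mathbf{n})}_0\cup I^{(\mathbf{n})}_1$. $\mathcal{L}(I^{(\mathbf{n})})$ is the vector space of all functions $I^{(\mathbf{n})}\to\mathbb{C}$. For $\mathbf{i}\in I^{(\mathbf{n})}$ put $\mathfrak{w}^{(\mathbf{n})}_{\mathbf{i}}=2^{\#M}/(2p[\mathbf{n}])$, where $M=\{j\mid 0<i_j<n_j\}$. The measure $\omega^{(\mathbf{n})}$ on the power set of $I^{(\mathbf{n})}$ is given by $\omega^{(\mathbf{n})}(\{\mathbf{i}\})=\mathfrak{w}^{(\mathbf{n})}_{\mathbf{i}}$, the inner product is $\langle f_1,f_2\rangle_{\omega^{(\mathbf{n})}}=\int f_1\overline{f_2}\,d\omega^{(\mathbf{n})}=\sum_{\mathbf{i}\in I^{(\mathbf{n})}}\mathfrak{w}^{(\mathbf{n})}_{\mathbf{i}}f_1(\mathbf{i})\overline{f_2(\mathbf{i})}$, and $\|\cdot\|_{\omega^{(\mathbf{n})}}$ is the corresponding norm. For $\boldsymbol{\gamma}\in\mathbb{N}_0^d$, $\chi^{(\mathbf{n})}_{\boldsymbol{\gamma}}(\mathbf{i})=\prod_{j=1}^d\cos(\gamma_ji_j\pi/n_j)$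 for $\mathbf{i}\in I^{(\mathbf{n})}$, and $\mathfrak{e}(\boldsymbol{\gamma})=\#\{i\mid\gamma_i>0\}$. $\Gamma^{(\mathbf{n})}$ is the union of $\{(0,\ldots,0,n_d)\}$ and the set of all $\boldsymbol{\gamma}\in\mathbb{N}_0^d$ such that $\gamma_i<n_i$ for all $i$ and $\gamma_i/n_i+\gamma_j/n_j<1$ for all $i\neq j$. *)

theory Defs
  imports "HOL-Analysis.Analysis" "HOL-Library.Function_Algebras"
begin

text \<open>
  A \<open>d\<close>-tuple of natural numbers is a function on the index set \<open>{1..d}\<close>, made unique by
  \<^const>\<open>extensional\<close> wherever tuples are collected in a set. The tuple \<open>n\<close> is only ever
  evaluated on \<open>{1..d}\<close>.
\<close>

definition nprod :: "nat \<Rightarrow> (nat \<Rightarrow> nat) \<Rightarrow> nat" where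
  "nprod d n = (\<Prod>j\<in>{1..d}. n j)"

definition LC_parity :: "nat \<Rightarrow> (nat \<Rightarrow> nat) \<Rightarrow> nat \<Rightarrow> (nat \<Rightarrow> nat) set" where
  "LC_parity d n r =
     {i \<in> extensional {1..d}. \<forall>j\<in>{1..d}. 0 \<le> i j \<and> i j \<le> n j \<and> i j mod 2 = r mod 2}"

definition LC_index :: "nat \<Rightarrow> (nat \<Rightarrow> nat) \<Rightarrow> (nat \<Rightarrow> nat) set" where
  "LC_index d n = LC_parity d n 0 \<union> LC_parity d n 1"

text \<open>
  The space of all functions \<open>A \<rightarrow> \<complex>\<close>, realised as the total functions vanishing outside \<open>A\<close>
  (so that it is a subspace of the space of all total functions).
\<close>

definition fun_space :: "'a set \<Rightarrow> ('a \<Rightarrow> complex) set" where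
  "fun_space A = {f. \<forall>x. x \<notin> A \<longrightarrow> f x = 0}"

global_interpretation cfun: vector_space "\<lambda>(c::complex) (f::'a \<Rightarrow> complex) x. c * f x"
  by unfold_locales (auto simp: fun_eq_iff algebra_simps)

lemma subspace_fun_space: "cfun.subspace (fun_space A)"
  by (auto simp: cfun.subspace_def fun_space_def)

definition LC_weight :: "nat \<Rightarrow> (nat \<Rightarrow> nat) \<Rightarrow> (nat \<Rightarrow> nat) \<Rightarrow> real" where
  "LC_weight d n i = 2 ^ card {j \<in> {1..d}. 0 < i j \<and> i j < n j} / (2 * real (nprod d n))"

definition LC_measure :: "nat \<Rightarrow> (nat \<Rightarrow> nat) \<Rightarrow> (nat \<Rightarrow> nat) measure" where
  "LC_measure d n = point_measure (LC_index d n) (\<lambda>i. ennreal (LC_weight d n i))"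

definition LC_inner ::
  "nat \<Rightarrow> (nat \<Rightarrow> nat) \<Rightarrow> ((nat \<Rightarrow> nat) \<Rightarrow> complex) \<Rightarrow> ((nat \<Rightarrow> nat) \<Rightarrow> complex) \<Rightarrow> complex" where
  "LC_inner d n f g = (LINT i|LC_measure d n. f i * cnj (g i))"

definition LC_norm :: "nat \<Rightarrow> (nat \<Rightarrow> nat) \<Rightarrow> ((nat \<Rightarrow> nat) \<Rightarrow> complex) \<Rightarrow> real" where
  "LC_norm d n f = sqrt (Re (LC_inner d n f f))"

definition LC_chi :: "nat \<Rightarrow> (nat \<Rightarrow> nat) \<Rightarrow> (nat \<Rightarrow> nat) \<Rightarrow> (nat \<Rightarrow> nat) \<Rightarrow> complex" where
  "LC_chi d n \<gamma> i =
     (if i \<in> LC_index d n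
      then complex_of_real (\<Prod>j\<in>{1..d}. cos (real (\<gamma> j) * real (i j) * pi / real (n j)))
      else 0)"

definition num_pos :: "nat \<Rightarrow> (nat \<Rightarrow> nat) \<Rightarrow> nat" where
  "num_pos d \<gamma> = card {j \<in> {1..d}. \<gamma> j > 0}"

text \<open>The tuple \<open>(0, \<dots>, 0, n\<^sub>d)\<close>.\<close>

definition last_tuple :: "nat \<Rightarrow> (nat \<Rightarrow> nat) \<Rightarrow> (nat \<Rightarrow> nat)" where
  "last_tuple d n = (\<lambda>j\<in>{1..d}. if j = d then n d else 0)"

definition LC_Gamma :: "nat \<Rightarrow> (nat \<Rightarrow> nat) \<Rightarrow> (nat \<Rightarrow> nat) set" where
  "LC_Gamma d n =
     {last_tuple d n} \<union>
     {\<gamma> \<in> extensional {1..d}.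
        (\<forall>i\<in>{1..d}. \<gamma> i < n i) \<and>
        (\<forall>i\<in>{1..d}. \<forall>j\<in>{1..d}. i \<noteq> j \<longrightarrow>
           real (\<gamma> i) / real (n i) + real (\<gamma> j) / real (n j) < 1)}"

text \<open>
  The family \<open>b k\<close>, \<open>k \<in> K\<close>, is an orthogonal basis of the complex function space \<open>V\<close> with
  respect to the inner product \<open>ip\<close>. Injectivity is included because a basis is a family, whereas
  linear independence is a property of the set of its members.
\<close>

definition orthogonal_basis ::
  "('a \<Rightarrow> complex) set \<Rightarrow> (('a \<Rightarrow> complex) \<Rightarrow> ('a \<Rightarrow> complex) \<Rightarrow> complex)
     \<Rightarrow> ('k \<Rightarrow> 'a \<Rightarrow> complex) \<Rightarrow> 'k set \<Rightarrow> bool" where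
  "orthogonal_basis V ip b K \<longleftrightarrow>
     inj_on b K \<and> cfun.independent (b ` K) \<and> cfun.span (b ` K) = V \<and>
     (\<forall>k\<in>K. \<forall>l\<in>K. k \<noteq> l \<longrightarrow> ip (b k) (b l) = 0)"


lemma finite_LC_index: "finite (LC_index d n)"
proof (rule finite_subset)
  show "LC_index d n \<subseteq> (\<Pi>\<^sub>E j\<in>{1..d}. {..n j})"
    by (auto simp: LC_index_def LC_parity_def PiE_def)
  show "finite (\<Pi>\<^sub>E j\<in>{1..d}. {..n j})"
    by (intro finite_PiE) auto
qed

lemma LC_weight_nonneg: "LC_weight d n i \<ge> 0"
  by (simp add: LC_weight_def)

lemma LC_weight_pos:
  assumes "\<And>j. j \<in> {1..d} \<Longrightarrow> n j \<ge> 1"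
  shows "LC_weight d n i > 0"
proof -
  have "nprod d n > 0"
    unfolding nprod_def using assms by (intro prod_pos) force
  thus ?thesis by (simp add: LC_weight_def)
qed

lemma emeasure_LC_measure:
  assumes "i \<in> LC_index d n"
  shows "emeasure (LC_measure d n) {i} = ennreal (LC_weight d n i)"
  using assms finite_LC_index[of d n]
  by (simp add: LC_measure_def emeasure_point_measure_finite)

lemma LC_inner_eq_sum:
  "LC_inner d n f g =
     (\<Sum>i\<in>LC_index d n. complex_of_real (LC_weight d n i) * f i * cnj (g i))"
  unfolding LC_inner_def LC_measure_def
  by (subst lebesgue_integral_point_measure_finite)
     (auto simp: finite_LC_index LC_weight_nonneg scaleR_conv_of_real mult.assoc)

text \<open>\<^const>\<open>LC_inner\<close> is an inner product on \<^term>\<open>fun_space (LC_index d n)\<close>.\<close>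

lemma LC_inner_add_left: "LC_inner d n (f + g) h = LC_inner d n f h + LC_inner d n g h"
  by (simp add: LC_inner_eq_sum algebra_simps sum.distrib)

lemma LC_inner_scale_left: "LC_inner d n (\<lambda>x. c * f x) h = c * LC_inner d n f h"
  by (simp add: LC_inner_eq_sum sum_distrib_left mult_ac)

lemma LC_inner_commute: "LC_inner d n g f = cnj (LC_inner d n f g)"
  by (simp add: LC_inner_eq_sum mult_ac)

lemma LC_inner_self:
  "LC_inner d n f f =
     complex_of_real (\<Sum>i\<in>LC_index d n. LC_weight d n i * (cmod (f i))\<^sup>2)"
  by (simp add: LC_inner_eq_sum mult.assoc complex_norm_square del: of_real_power)

lemma LC_inner_pos:
  assumes "\<And>j. j \<in> {1..d} \<Longrightarrow> n j \<ge> 1"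
    and "f \<in> fun_space (LC_index d n)" and "f \<noteq> 0"
  shows "Im (LC_inner d n f f) = 0" and "Re (LC_inner d n f f) > 0"
proof -
  show "Im (LC_inner d n f f) = 0"
    by (simp add: LC_inner_self)
  from assms(2,3) obtain x where x: "x \<in> LC_index d n" "f x \<noteq> 0"
    by (auto simp: fun_space_def fun_eq_iff)
  have "0 < (\<Sum>i\<in>LC_index d n. LC_weight d n i * (cmod (f i))\<^sup>2)"
    using x LC_weight_pos[of d n x, OF assms(1)]
    by (intro sum_pos2[OF finite_LC_index, of x]) (auto simp: LC_weight_nonneg)
  thus "Re (LC_inner d n f f) > 0"
    by (simp add: LC_inner_self)
qed

lemma LC_chi_in_fun_space: "LC_chi d n \<gamma> \<in> fun_space (LC_index d n)"
  by (simp add: LC_chi_def fun_space_def)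

end

theory Submission
  imports Defs
begin

text \<open>
  On the class \<open>LC_parity d n r\<close> the weight is a product over the coordinates, so each inner product
  of two functions \<open>\<chi>\<close> is a sum over \<open>r = 0, 1\<close> of products of one-dimensional sums. By folding and
  roots of unity, the factor at \<open>j\<close> is
  \<open>([g\<^sub>j = h\<^sub>j] + [g\<^sub>j = h\<^sub>j = 0] + (-1)\<^sup>r [g\<^sub>j + h\<^sub>j = n\<^sub>j]) / 2\<close>. For two indices in \<open>\<Gamma>\<close> at most one
  coordinate can satisfy \<open>g\<^sub>j + h\<^sub>j = n\<^sub>j\<close>, so the signed term cancels in the sum over \<open>r\<close>.

  For spanning, products of one-dimensional discrete cosine transforms show that the \<open>\<chi>\<close> with
  \<open>0 \<le> \<gamma>\<^sub>j \<le> n\<^sub>j\<close> span everything. Replacing \<open>\<gamma>\<^sub>j\<close> and \<open>\<gamma>\<^sub>k\<close> by \<open>n\<^sub>j - \<gamma>\<^sub>j\<close> and \<open>n\<^sub>k - \<gamma>\<^sub>k\<close> multiplies \<open>\<chi>\<close> by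
  \<open>(-1)\<^bsup>i\<^sub>j + i\<^sub>k\<^esup> = 1\<close>. A tuple that minimises \<open>\<Sum> \<gamma>\<^sub>j / n\<^sub>j\<close> among those with the same \<open>\<chi>\<close> has
  \<open>\<gamma>\<^sub>j / n\<^sub>j + \<gamma>\<^sub>k / n\<^sub>k \<le> 1\<close> for all \<open>j \<noteq> k\<close>, and coprimality allows equality only if one of the two
  entries is \<open>0\<close> and the other one is maximal, where \<open>\<chi>\<close> equals that of \<open>(0, \<dots>, 0, n\<^sub>d)\<close>.
\<close>

section \<open>One-dimensional cosine sums over a parity class\<close>

text \<open>This is the real part of a geometric series whose ratio \<open>cis \<theta>\<close> is
  an \<open>N\<close>-th root of unity, equal to 1 exactly when \<open>N\<close> divides
  \<open>m\<close>.\<close>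

lemma sum_cos_equidistant:
  fixes a :: real and m :: int
  assumes N: "N > 0"
  shows "(\<Sum>k<N. cos (a + 2 * pi * of_int m * real k / real N)) =
         (if int N dvd m then real N * cos a else 0)"
proof (cases "int N dvd m")
  case True
  then obtain q where q: "m = int N * q" by auto
  have "cos (a + 2 * pi * of_int m * real k / real N) = cos a" for k
  proof -
    have "2 * pi * of_int m * real k / real N = 2 * pi * of_int (q * int k)"
      using N by (simp add: q)
    moreover have "sin (2 * pi * of_int (q * int k)) = 0"
      by (rule sin_integer_2pi) (rule Ints_of_int)
    ultimately show ?thesis
      by (metis cos_add cos_int_2pin diff_zero mult.right_neutral mult_zero_right)
  qed
  with True show ?thesis by simp
next
  case False
  define \<theta> where "\<theta> = 2 * pi * of_int m / real N"
  have "cis \<theta> \<noteq> 1"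
  proof
    assume "cis \<theta> = 1"
    then have "cos \<theta> = 1" by (simp add: complex_eq_iff)
    then obtain q :: int where "\<theta> = of_int q * 2 * pi"
      by (auto simp: cos_one_2pi_int)
    then have "real_of_int m = of_int (q * int N)"
      using N by (simp add: \<theta>_def field_simps)
    then have "m = q * int N" by (simp only: of_int_eq_iff)
    with False show False by simp
  qed
  moreover have "cis \<theta> ^ N = 1"
  proof -
    have "cis \<theta> ^ N = cis (real N * \<theta>)" by (rule Complex.DeMoivre)
    also have "real N * \<theta> = 2 * pi * of_int m" using N by (simp add: \<theta>_def)
    finally have "cis \<theta> ^ N = cis (2 * pi * of_int m)" .
    then show ?thesis by (simp add: cis_multiple_2pi)
  qed
  ultimately have "(\<Sum>k<N. cis a * cis \<theta> ^ k) = 0"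
    by (simp add: geometric_sum flip: sum_distrib_left)
  moreover have "cis a * cis \<theta> ^ k = cis (a + 2 * pi * of_int m * real k / real N)" for k
    by (simp add: cis_mult Complex.DeMoivre \<theta>_def mult_ac)
  ultimately have "Re (\<Sum>k<N. cis (a + 2 * pi * of_int m * real k / real N)) = 0"
    by simp
  with False show ?thesis by simp
qed

text \<open>The factor of one coordinate in \<open>LC_weight\<close>, before normalisation: an
  interior point counts twice because it stands for two points of a full period
  \<open>2 * n\<close>.\<close>

definition end_wt :: "nat \<Rightarrow> nat \<Rightarrow> real" where
  "end_wt n i = (if 0 < i \<and> i < n then 2 else 1)"

text \<open>The reflection of \<open>i\<close> to \<open>2 * n - i\<close> matches the points
  strictly between 0 and \<open>n\<close> with those strictly between \<open>n\<close> and
  \<open>2 * n\<close>; 0 and \<open>n\<close> stay single.\<close>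

lemma sum_end_wt_fold:
  fixes f :: "nat \<Rightarrow> real"
  assumes n: "n \<ge> 1" and sym: "\<And>i. i \<le> n \<Longrightarrow> f (2 * n - i) = f i"
  shows "(\<Sum>i\<le>n. end_wt n i * f i) = (\<Sum>i<2 * n. f i)"
proof -
  have refl: "(\<Sum>i\<in>{n<..<2 * n}. f i) = (\<Sum>i\<in>{0<..<n}. f i)"
    by (rule sum.reindex_bij_witness[of _ "\<lambda>i. 2 * n - i" "\<lambda>i. 2 * n - i"])
       (use sym[symmetric] in auto)
  have 1: "{..n} = {0, n} \<union> {0<..<n}" and 2: "{..<2 * n} = ({0, n} \<union> {0<..<n}) \<union> {n<..<2 * n}"
    using n by auto
  have "(\<Sum>i<2 * n. f i) = (\<Sum>i\<in>{0, n}. f i) + (\<Sum>i\<in>{0<..<n}. f i) + (\<Sum>i\<in>{0<..<n}. f i)"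
    unfolding 2 by (subst sum.union_disjoint; (subst sum.union_disjoint)?) (auto simp: refl)
  also have "\<dots> = (\<Sum>i\<in>{0, n}. end_wt n i * f i) + (\<Sum>i\<in>{0<..<n}. end_wt n i * f i)"
    using n by (simp add: end_wt_def flip: sum_distrib_left)
  also have "\<dots> = (\<Sum>i\<le>n. end_wt n i * f i)"
    unfolding 1 by (subst sum.union_disjoint) auto
  finally show ?thesis ..
qed

text \<open>If \<open>f (2 * n - i) = f i\<close>, this is the average of \<open>f\<close> over the
  \<open>n\<close> points below \<open>2 * n\<close> that have the parity of
  \<open>r\<close>.\<close>

definition par_mean :: "nat \<Rightarrow> nat \<Rightarrow> (nat \<Rightarrow> real) \<Rightarrow> real" where
  "par_mean n r f = (\<Sum>i | i \<le> n \<and> i mod 2 = r mod 2. end_wt n i * f i) / real n"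

lemma sum_parity_class:
  fixes f :: "nat \<Rightarrow> real"
  assumes "r < 2"
  shows "(\<Sum>i<2 * n. if i mod 2 = r then f i else 0) = (\<Sum>k<n. f (r + 2 * k))"
proof -
  from assms consider "r = 0" | "r = 1" by linarith
  then show ?thesis by cases (induction n; simp)+
qed

lemma cos_reflect:
  fixes m :: int
  assumes "n \<ge> 1" "i \<le> 2 * n"
  shows "cos (of_int m * real (2 * n - i) * pi / real n) = cos (of_int m * real i * pi / real n)"
proof -
  have "of_int m * real (2 * n - i) * pi / real n = 2 * pi * of_int m - of_int m * real i * pi / real n"
    using assms by (simp add: of_nat_diff field_simps)
  then show ?thesis by (simp add: cos_diff cos_int_2pin sin_integer_2pi)
qed

text \<open>Unfolded to a full period, the parity class consists of the equidistant points
  \<open>r + 2 * k\<close>, so the sum is one over \<open>n\<close>-th roots of unity.\<close>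

lemma par_mean_cos:
  fixes m :: int
  assumes n: "n \<ge> 1" and r: "r < 2"
  shows "par_mean n r (\<lambda>i. cos (of_int m * real i * pi / real n)) =
         (if int n dvd m then cos (of_int m * real r * pi / real n) else 0)"
proof -
  define f where "f i = cos (of_int m * real i * pi / real n)" for i
  \<comment> \<open>Folding works on the whole range, so the parity condition moves into the
    summand; reflection preserves it.\<close>
  have "(\<Sum>i | i \<le> n \<and> i mod 2 = r mod 2. end_wt n i * f i) =
        (\<Sum>i\<le>n. end_wt n i * (if i mod 2 = r then f i else 0))"
    using r by (intro sum.mono_neutral_cong_left) auto
  also have "\<dots> = (\<Sum>i<2 * n. if i mod 2 = r then f i else 0)"
  proof (rule sum_end_wt_fold[OF n])
    fix i assume "i \<le> n"
    then have "2 * n - i = i + 2 * (n - i)" by simp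
    then have "(2 * n - i) mod 2 = i mod 2" by simp
    moreover have "f (2 * n - i) = f i"
      unfolding f_def using n \<open>i \<le> n\<close> by (intro cos_reflect) auto
    ultimately show "(if (2 * n - i) mod 2 = r then f (2 * n - i) else 0) =
      (if i mod 2 = r then f i else 0)" by simp
  qed
  also have "\<dots> = (\<Sum>k<n. f (r + 2 * k))" by (rule sum_parity_class[OF r])
  also have "\<dots> = (\<Sum>k<n. cos (of_int m * real r * pi / real n + 2 * pi * of_int m * real k / real n))"
    by (simp add: f_def add_divide_distrib algebra_simps)
  also have "\<dots> = (if int n dvd m then real n * cos (of_int m * real r * pi / real n) else 0)"
    using n by (intro sum_cos_equidistant) simp
  finally show ?thesis using n by (simp add: par_mean_def f_def)
qed

text \<open>The product splits into the frequencies \<open>g - h\<close> and \<open>g + h\<close>.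
  The first lies strictly between \<open>-n\<close> and \<open>n\<close>, so \<open>n\<close>
  divides it only if it is 0. The second is below \<open>2 * n\<close>, so only 0 and
  \<open>n\<close> survive, and \<open>n\<close> contributes \<open>cos (r * pi)\<close>, the sign
  \<open>(-1) ^ r\<close>.\<close>

lemma par_mean_cos_mult_cos:
  assumes r: "r < 2" and g: "g < n" and h: "h < n"
  shows "par_mean n r (\<lambda>i. cos (real g * real i * pi / real n) * cos (real h * real i * pi / real n)) =
    (of_bool (g = h) + of_bool (g = 0 \<and> h = 0) + (-1) ^ r * of_bool (g + h = n)) / 2"
proof -
  have n: "n \<ge> 1" using g by simp
  define d s where "d = int g - int h" and "s = int g + int h"
  have "cos (real g * real i * pi / real n) * cos (real h * real i * pi / real n) =
    (cos (of_int d * real i * pi / real n) + cos (of_int s * real i * pi / real n)) / 2" for i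
    by (simp add: d_def s_def cos_times_cos diff_divide_distrib add_divide_distrib algebra_simps)
  then have "par_mean n r (\<lambda>i. cos (real g * real i * pi / real n) * cos (real h * real i * pi / real n)) =
    (par_mean n r (\<lambda>i. cos (of_int d * real i * pi / real n)) +
     par_mean n r (\<lambda>i. cos (of_int s * real i * pi / real n))) / 2"
    by (simp add: par_mean_def sum.distrib distrib_left add_divide_distrib mult.commute
        flip: sum_divide_distrib)
  moreover have "par_mean n r (\<lambda>i. cos (of_int d * real i * pi / real n)) = of_bool (g = h)"
  proof -
    have "int n dvd d \<longleftrightarrow> g = h"
    proof
      assume "int n dvd d"
      then show "g = h" using g h dvd_imp_le_int[of d "int n"] by (cases "d = 0") (auto simp: d_def)
    qed (simp add: d_def)
    then show ?thesis unfolding par_mean_cos[OF n r] by (simp add: d_def)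
  qed
  moreover have "par_mean n r (\<lambda>i. cos (of_int s * real i * pi / real n)) =
      of_bool (g = 0 \<and> h = 0) + (-1) ^ r * of_bool (g + h = n)"
  proof -
    consider "g = 0 \<and> h = 0" | "g + h = n" | "g + h \<noteq> n" "\<not> (g = 0 \<and> h = 0)"
      by blast
    then show ?thesis
    proof cases
      case 3
      have "\<not> int n dvd s"
      proof
        assume "int n dvd s"
        then have "n dvd g + h" by (simp add: s_def flip: of_nat_add)
        then obtain q where q: "g + h = n * q" by auto
        have "q \<noteq> 0" "q \<noteq> 1" by (rule notI; use 3 q in simp)+
        then have "n * 2 \<le> n * q" by (intro mult_le_mono) auto
        then show False using q g h by linarith
      qed
      then show ?thesis unfolding par_mean_cos[OF n r] using 3 by auto
    next
      case 2
      then have "s = int n" by (simp add: s_def)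
      then show ?thesis unfolding par_mean_cos[OF n r] using 2 n r
        by (auto simp: less_2_cases_iff)
    next
      case 1
      then show ?thesis unfolding par_mean_cos[OF n r] using n by (simp add: s_def)
    qed
  qed
  ultimately show ?thesis by simp
qed

section \<open>Factorisation of the inner product on each parity class\<close>

lemma LC_parity_PiE: "LC_parity d n r = (\<Pi>\<^sub>E j\<in>{1..d}. {i. i \<le> n j \<and> i mod 2 = r mod 2})"
  by (simp add: set_eq_iff LC_parity_def PiE_iff conj_commute)

lemma LC_weight_prod: "LC_weight d n i = (\<Prod>j\<in>{1..d}. end_wt (n j) (i j) / real (n j)) / 2"
proof -
  have "(\<Prod>j\<in>{1..d}. end_wt (n j) (i j)) = 2 ^ card {j \<in> {1..d}. 0 < i j \<and> i j < n j}"
    by (simp add: end_wt_def prod.If_cases Int_def)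
  then show ?thesis by (simp add: LC_weight_def nprod_def prod_dividef)
qed

text \<open>A parity class is a Cartesian product and the weight is a product over the coordinates,
  so the sum of products is a product of sums. The final 2 is the one in the denominator of
  \<open>LC_weight\<close>.\<close>

lemma sum_LC_parity:
  "(\<Sum>i\<in>LC_parity d n r. LC_weight d n i * (\<Prod>j\<in>{1..d}. f j (i j))) =
   (\<Prod>j\<in>{1..d}. par_mean (n j) r (f j)) / 2"
proof -
  have "(\<Prod>j\<in>{1..d}. par_mean (n j) r (f j)) =
    (\<Prod>j\<in>{1..d}. \<Sum>i | i \<le> n j \<and> i mod 2 = r mod 2. end_wt (n j) i / real (n j) * f j i)"
    by (simp add: par_mean_def sum_divide_distrib)
  also have "\<dots> = (\<Sum>i\<in>LC_parity d n r. \<Prod>j\<in>{1..d}. end_wt (n j) (i j) / real (n j) * f j (i j))"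
    unfolding LC_parity_PiE by (rule prod_sum_PiE) auto
  finally have "(\<Prod>j\<in>{1..d}. par_mean (n j) r (f j)) / 2 =
      (\<Sum>i\<in>LC_parity d n r. (\<Prod>j\<in>{1..d}. end_wt (n j) (i j) / real (n j) * f j (i j)) / 2)"
    by (simp only: sum_divide_distrib)
  moreover have "LC_weight d n i * (\<Prod>j\<in>{1..d}. f j (i j)) =
      (\<Prod>j\<in>{1..d}. end_wt (n j) (i j) / real (n j) * f j (i j)) / 2" for i
    unfolding LC_weight_prod prod.distrib by (rule times_divide_eq_left)
  ultimately show ?thesis by (simp only:)
qed

text \<open>\<open>d \<ge> 1\<close> makes the classes disjoint; for \<open>d = 0\<close> both
  consist of the empty tuple.\<close>

lemma sum_LC_index:
  assumes "d \<ge> 1"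
  shows "(\<Sum>i\<in>LC_index d n. f i) = (\<Sum>i\<in>LC_parity d n 0. f i) + (\<Sum>i\<in>LC_parity d n 1. f i)"
proof -
  have "LC_parity d n 0 \<inter> LC_parity d n 1 = {}"
    using assms by (fastforce simp: LC_parity_def)
  moreover have "finite (LC_parity d n 0)" "finite (LC_parity d n 1)"
    using finite_LC_index[of d n] by (auto simp: LC_index_def)
  ultimately show ?thesis unfolding LC_index_def by (rule sum.union_disjoint[rotated 2])
qed

text \<open>The real formula behind \<open>LC_chi\<close>, without the cutoff outside
  \<open>LC_index\<close>.\<close>

definition cos_prod :: "nat \<Rightarrow> (nat \<Rightarrow> nat) \<Rightarrow> (nat \<Rightarrow> nat) \<Rightarrow> (nat \<Rightarrow> nat) \<Rightarrow> real" where
  "cos_prod d n \<gamma> i = (\<Prod>j\<in>{1..d}. cos (real (\<gamma> j) * real (i j) * pi / real (n j)))"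

lemma LC_chi_eq_cos_prod:
  "i \<in> LC_index d n \<Longrightarrow> LC_chi d n \<gamma> i = of_real (cos_prod d n \<gamma> i)"
  by (simp add: LC_chi_def cos_prod_def)

definition par_inner :: "nat \<Rightarrow> (nat \<Rightarrow> nat) \<Rightarrow> nat \<Rightarrow> (nat \<Rightarrow> nat) \<Rightarrow> (nat \<Rightarrow> nat) \<Rightarrow> real" where
  "par_inner d n r g h =
     (\<Sum>i\<in>LC_parity d n r. LC_weight d n i * (cos_prod d n g i * cos_prod d n h i))"

lemma LC_inner_chi:
  assumes "d \<ge> 1"
  shows "LC_inner d n (LC_chi d n g) (LC_chi d n h) = of_real (par_inner d n 0 g h + par_inner d n 1 g h)"
proof -
  have "LC_inner d n (LC_chi d n g) (LC_chi d n h) =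
    of_real (\<Sum>i\<in>LC_index d n. LC_weight d n i * (cos_prod d n g i * cos_prod d n h i))"
    by (simp add: LC_inner_eq_sum LC_chi_eq_cos_prod mult.assoc)
  then show ?thesis unfolding sum_LC_index[OF assms] par_inner_def .
qed

lemma par_inner_eq_prod:
  assumes "r < 2" and "\<forall>j\<in>{1..d}. g j < n j" and "\<forall>j\<in>{1..d}. h j < n j"
  shows "par_inner d n r g h = (\<Prod>j\<in>{1..d}.
    (of_bool (g j = h j) + of_bool (g j = 0 \<and> h j = 0) + (-1) ^ r * of_bool (g j + h j = n j)) / 2) / 2"
proof -
  have "par_inner d n r g h = (\<Prod>j\<in>{1..d}. par_mean (n j) r
    (\<lambda>i. cos (real (g j) * real i * pi / real (n j)) * cos (real (h j) * real i * pi / real (n j)))) / 2"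
    unfolding par_inner_def cos_prod_def prod.distrib[symmetric] by (rule sum_LC_parity)
  also have "\<dots> = (\<Prod>j\<in>{1..d}.
    (of_bool (g j = h j) + of_bool (g j = 0 \<and> h j = 0) + (-1) ^ r * of_bool (g j + h j = n j)) / 2) / 2"
    using assms by (intro arg_cong2[where f = "(/)"] prod.cong refl par_mean_cos_mult_cos) auto
  finally show ?thesis .
qed

section \<open>Orthogonality and norms\<close>

text \<open>The tuple \<open>last_tuple\<close> is split off because its entry \<open>n d\<close> is
  outside the range of \<open>par_inner_eq_prod\<close>.\<close>

definition LC_Gamma_strict :: "nat \<Rightarrow> (nat \<Rightarrow> nat) \<Rightarrow> (nat \<Rightarrow> nat) set" where
  "LC_Gamma_strict d n = {\<gamma> \<in> extensional {1..d}.
     (\<forall>i\<in>{1..d}. \<gamma> i < n i) \<and>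
     (\<forall>i\<in>{1..d}. \<forall>j\<in>{1..d}. i \<noteq> j \<longrightarrow>
        real (\<gamma> i) / real (n i) + real (\<gamma> j) / real (n j) < 1)}"

lemma LC_Gamma_eq: "LC_Gamma d n = insert (last_tuple d n) (LC_Gamma_strict d n)"
  by (simp add: LC_Gamma_def LC_Gamma_strict_def)

text \<open>Two such coordinates would make the four fractions sum to 2, whereas the inequalities
  for \<open>g\<close> and for \<open>h\<close> bound the sum strictly below 2.\<close>

lemma LC_Gamma_strict_complement_unique:
  assumes "g \<in> LC_Gamma_strict d n" "h \<in> LC_Gamma_strict d n"
    and "j \<in> {1..d}" "k \<in> {1..d}" "j \<noteq> k" "g j + h j = n j"
  shows "g k + h k \<noteq> n k"
proof
  assume k: "g k + h k = n k"
  have g: "real (g j) / real (n j) + real (g k) / real (n k) < 1" "g j < n j" "g k < n k"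
    and h: "real (h j) / real (n j) + real (h k) / real (n k) < 1"
    using assms unfolding LC_Gamma_strict_def by blast+
  have "real (g j) / real (n j) + real (h j) / real (n j) = 1"
    using g(2) assms(6) by (simp flip: add_divide_distrib of_nat_add)
  moreover have "real (g k) / real (n k) + real (h k) / real (n k) = 1"
    using g(3) k by (simp flip: add_divide_distrib of_nat_add)
  ultimately show False using g h by linarith
qed

text \<open>At a coordinate \<open>j\<close> where \<open>g\<close> and \<open>h\<close> differ, the
  factor vanishes unless \<open>g j + h j = n j\<close>. In that case it is
  \<open>(-1) ^ r / 2\<close> and no other factor depends on \<open>r\<close>, so the two classes
  cancel.\<close>

lemma LC_inner_strict_orthogonal:
  assumes d: "d \<ge> 1" and g: "g \<in> LC_Gamma_strict d n" and h: "h \<in> LC_Gamma_strict d n" and "g \<noteq> h"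
  shows "LC_inner d n (LC_chi d n g) (LC_chi d n h) = 0"
proof -
  have lt: "\<forall>j\<in>{1..d}. g j < n j" "\<forall>j\<in>{1..d}. h j < n j"
    using g h by (auto simp: LC_Gamma_strict_def)
  have "g \<in> extensional {1..d}" "h \<in> extensional {1..d}"
    using g h by (auto simp: LC_Gamma_strict_def)
  with \<open>g \<noteq> h\<close> obtain j where j: "j \<in> {1..d}" "g j \<noteq> h j"
    by (meson extensionalityI)
  let ?F = "\<lambda>r j. (of_bool (g j = h j) + of_bool (g j = 0 \<and> h j = 0) + (-1) ^ r * of_bool (g j + h j = n j)) / 2 :: real"
  let ?P = "\<lambda>r. \<Prod>k\<in>{1..d} - {j}. ?F r k"
  have eq: "par_inner d n r g h = ?F r j * ?P r / 2" if "r < 2" for r :: nat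
  proof -
    have "(\<Prod>k\<in>{1..d}. ?F r k) = ?F r j * ?P r" by (rule prod.remove) (use j(1) in auto)
    then show ?thesis unfolding par_inner_eq_prod[of r d g n h, OF that lt] by (simp only:)
  qed
  have "?F 0 j * ?P 0 + ?F 1 j * ?P 1 = 0"
  proof (cases "g j + h j = n j")
    case True
    have "?P 0 = ?P 1"
    proof (rule prod.cong)
      fix k assume "k \<in> {1..d} - {j}"
      then have "g k + h k \<noteq> n k"
        using LC_Gamma_strict_complement_unique[OF g h j(1) _ _ True, of k] by auto
      then show "?F 0 k = ?F 1 k" by simp
    qed simp
    moreover have "?F 0 j = - ?F 1 j" using j by auto
    ultimately show ?thesis by simp
  next
    case False
    then have "?F 0 j = 0" "?F 1 j = 0" using j by auto
    then show ?thesis by (simp only: mult_zero_left add_0)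
  qed
  then have "par_inner d n 0 g h + par_inner d n 1 g h = 0"
    using eq[of 0] eq[of 1] by (simp flip: add_divide_distrib)
  then show ?thesis by (simp add: LC_inner_chi[OF d])
qed

lemma prod_half_num_pos:
  "(\<Prod>j\<in>{1..d}. (1 + of_bool (g j = 0)) / 2 :: real) = 1 / 2 ^ num_pos d g"
proof -
  have "(\<Prod>j\<in>{1..d}. (1 + of_bool (g j = 0)) / 2 :: real) = (\<Prod>j\<in>{1..d}. if g j > 0 then 1 / 2 else 1)"
    by (rule prod.cong) auto
  then show ?thesis by (simp add: prod.If_cases num_pos_def Int_def power_one_over)
qed

text \<open>A coordinate with \<open>g j + g j = n j\<close> is unique if it exists. Its factor is 1
  for \<open>r = 0\<close> and 0 for \<open>r = 1\<close>, with the average 1/2 that a positive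
  entry contributes anyway.\<close>

lemma LC_inner_strict_self:
  assumes d: "d \<ge> 1" and g: "g \<in> LC_Gamma_strict d n"
  shows "LC_inner d n (LC_chi d n g) (LC_chi d n g) = of_real (1 / 2 ^ num_pos d g)"
proof -
  have lt: "\<forall>j\<in>{1..d}. g j < n j"
    using g by (auto simp: LC_Gamma_strict_def)
  let ?F = "\<lambda>r j. (of_bool (g j = g j) + of_bool (g j = 0 \<and> g j = 0) + (-1) ^ r * of_bool (g j + g j = n j)) / 2 :: real"
  let ?H = "\<lambda>j. (1 + of_bool (g j = 0)) / 2 :: real"
  have "(\<Prod>j\<in>{1..d}. ?F 0 j) + (\<Prod>j\<in>{1..d}. ?F 1 j) = 2 * (\<Prod>j\<in>{1..d}. ?H j)"
  proof (cases "\<exists>j\<in>{1..d}. g j + g j = n j")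
    case True
    then obtain j where j: "j \<in> {1..d}" "g j + g j = n j" by auto
    have P: "(\<Prod>k\<in>{1..d} - {j}. ?F r k) = (\<Prod>k\<in>{1..d} - {j}. ?H k)" for r :: nat
    proof (rule prod.cong)
      fix k assume "k \<in> {1..d} - {j}"
      then have "g k + g k \<noteq> n k"
        using LC_Gamma_strict_complement_unique[OF g g j(1) _ _ j(2), of k] by auto
      then show "?F r k = ?H k" by simp
    qed simp
    have "g j \<noteq> 0" using j(2) bspec[OF lt j(1)] by linarith
    then have "?F 0 j = 1" "?F 1 j = 0" "?H j = 1 / 2" using j by auto
    moreover have "(\<Prod>j\<in>{1..d}. ?F r j) = ?F r j * (\<Prod>k\<in>{1..d} - {j}. ?H k)" for r :: nat
      using j(1) by (subst prod.remove[of _ j]) (auto simp only: P finite_atLeastAtMost)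
    moreover have "(\<Prod>j\<in>{1..d}. ?H j) = ?H j * (\<Prod>k\<in>{1..d} - {j}. ?H k)"
      using j(1) by (subst prod.remove[of _ j]) auto
    ultimately show ?thesis by (simp only:)
  next
    case False
    then have "(\<Prod>j\<in>{1..d}. ?F r j) = (\<Prod>j\<in>{1..d}. ?H j)" for r :: nat
      by (intro prod.cong) auto
    then show ?thesis by (simp only: mult_2)
  qed
  then have "par_inner d n 0 g g + par_inner d n 1 g g = (\<Prod>j\<in>{1..d}. ?H j)"
    using par_inner_eq_prod[of 0 d g n g, OF _ lt lt] par_inner_eq_prod[of 1 d g n g, OF _ lt lt]
    by linarith
  then show ?thesis unfolding LC_inner_chi[OF d] prod_half_num_pos by simp
qed

text \<open>The entry \<open>n k\<close> contributes \<open>cos (i k * pi)\<close>, which only sees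
  the common parity. The value does not depend on \<open>k\<close>, so \<open>last_tuple\<close> can
  represent all these tuples.\<close>

lemma cos_prod_single_top:
  assumes i: "i \<in> LC_parity d n r" and k: "k \<in> {1..d}" and "n k \<ge> 1" and "\<gamma> k = n k"
    and 0: "\<And>j. j \<in> {1..d} \<Longrightarrow> j \<noteq> k \<Longrightarrow> \<gamma> j = 0"
  shows "cos_prod d n \<gamma> i = (-1) ^ r"
proof -
  have "cos_prod d n \<gamma> i = cos (real (\<gamma> k) * real (i k) * pi / real (n k)) *
     (\<Prod>j\<in>{1..d} - {k}. cos (real (\<gamma> j) * real (i j) * pi / real (n j)))"
    unfolding cos_prod_def using k by (subst prod.remove[of _ k]) auto
  also have "(\<Prod>j\<in>{1..d} - {k}. cos (real (\<gamma> j) * real (i j) * pi / real (n j))) = 1"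
    using 0 by (intro prod.neutral) simp
  also have "cos (real (\<gamma> k) * real (i k) * pi / real (n k)) = (-1) ^ i k"
    using assms(3,4) by simp
  also have "(-1) ^ i k = ((-1) ^ r :: real)"
  proof -
    have "even (i k) \<longleftrightarrow> even r" using i k by (auto simp: LC_parity_def even_iff_mod_2_eq_zero)
    then show ?thesis by (simp add: minus_one_power_iff)
  qed
  finally show ?thesis by simp
qed

lemma cos_prod_last_tuple:
  assumes "d \<ge> 1" "n d \<ge> 1" "i \<in> LC_parity d n r"
  shows "cos_prod d n (last_tuple d n) i = (-1) ^ r"
  using assms by (intro cos_prod_single_top[of _ _ _ _ d]) (auto simp: last_tuple_def)

lemma cos_prod_0: "cos_prod d n (\<lambda>_. 0) i = 1"
  by (simp add: cos_prod_def)

lemma par_inner_last: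
  assumes "d \<ge> 1" "n d \<ge> 1"
  shows "par_inner d n r g (last_tuple d n) = (-1) ^ r * par_inner d n r g (\<lambda>_. 0)"
  using assms by (simp add: par_inner_def cos_prod_last_tuple cos_prod_0 sum_distrib_left mult_ac)

text \<open>Up to the sign of the class, \<open>last_tuple\<close> acts like the zero tuple. Pairing
  \<open>g\<close> with the zero tuple gives the same value on both classes, as
  \<open>g j + 0 = n j\<close> never happens, so the signs cancel.\<close>

lemma LC_inner_strict_last:
  assumes d: "d \<ge> 1" and n: "\<And>j. j \<in> {1..d} \<Longrightarrow> n j \<ge> 1" and g: "g \<in> LC_Gamma_strict d n"
  shows "LC_inner d n (LC_chi d n g) (LC_chi d n (last_tuple d n)) = 0"
proof -
  have lt: "\<forall>j\<in>{1..d}. g j < n j"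
    using g by (auto simp: LC_Gamma_strict_def)
  have lt0: "\<forall>j\<in>{1..d}. 0 < n j"
    using n by force
  have "par_inner d n r g (\<lambda>_. 0) = (\<Prod>j\<in>{1..d}. of_bool (g j = 0)) / 2" if "r < 2" for r
    unfolding par_inner_eq_prod[of r d g n "\<lambda>_. 0", OF that lt lt0]
    by (intro arg_cong2[where f = "(/)"] prod.cong refl) (use lt in force)
  from this[of 0] this[of 1] show ?thesis
    using d n[of d] by (simp add: LC_inner_chi par_inner_last)
qed

text \<open>The sign squares to 1, which leaves the total mass of the measure, one half from each
  class.\<close>

lemma LC_inner_last_last:
  assumes d: "d \<ge> 1" and n: "\<And>j. j \<in> {1..d} \<Longrightarrow> n j \<ge> 1"
  shows "LC_inner d n (LC_chi d n (last_tuple d n)) (LC_chi d n (last_tuple d n)) = 1"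
proof -
  have lt: "\<forall>j\<in>{1..d}. 0 < n j"
    using n by force
  have half: "par_inner d n r (\<lambda>_. 0) (\<lambda>_. 0) = 1 / 2" if "r < 2" for r
    unfolding par_inner_eq_prod[of r d "\<lambda>_. 0" n "\<lambda>_. 0", OF that lt lt]
    by (intro arg_cong2[where f = "(/)"] prod.neutral refl) (use lt in force)
  have "par_inner d n r (last_tuple d n) (last_tuple d n) = par_inner d n r (\<lambda>_. 0) (\<lambda>_. 0)" for r
    using d n[of d] by (simp add: par_inner_def cos_prod_last_tuple cos_prod_0 flip: power_mult_distrib)
  then have "par_inner d n 0 (last_tuple d n) (last_tuple d n) +
      par_inner d n 1 (last_tuple d n) (last_tuple d n) = 1"
    using half[of 0] half[of 1] by simp
  then show ?thesis by (simp only: LC_inner_chi[OF d] of_real_1)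
qed

text \<open>The functions orthogonal to \<open>b k\<close> form a subspace that contains the other
  members, hence their span, but not \<open>b k\<close>.\<close>

lemma LC_orthogonal_independent:
  assumes orth: "\<And>k l. k \<in> K \<Longrightarrow> l \<in> K \<Longrightarrow> k \<noteq> l \<Longrightarrow> LC_inner d n (b k) (b l) = 0"
    and self: "\<And>k. k \<in> K \<Longrightarrow> LC_inner d n (b k) (b k) \<noteq> 0"
  shows "inj_on b K" and "cfun.independent (b ` K)"
proof -
  show "inj_on b K"
    using orth self by (metis inj_onI)
  show "cfun.independent (b ` K)"
  proof
    assume "cfun.dependent (b ` K)"
    then obtain k where k: "k \<in> K" "b k \<in> cfun.span (b ` K - {b k})"
      by (auto simp: cfun.dependent_def)
    let ?S = "{f. LC_inner d n f (b k) = 0}"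
    have "cfun.span (b ` K - {b k}) \<subseteq> ?S"
    proof (rule cfun.span_minimal)
      show "b ` K - {b k} \<subseteq> ?S" using orth k(1) by auto
      show "cfun.subspace ?S"
        by (auto simp: cfun.subspace_def LC_inner_add_left LC_inner_scale_left LC_inner_eq_sum[of _ _ 0])
    qed
    with k self show False by auto
  qed
qed

section \<open>Spanning by all frequencies in the box\<close>

text \<open>Here the sum runs over frequencies, for fixed points \<open>a\<close> and
  \<open>i\<close>. After folding, only multiples of \<open>2 * n\<close> among \<open>a - i\<close>
  and \<open>a + i\<close> survive; the second is one only at \<open>a = i = 0\<close> or
  \<open>a = i = n\<close>, which doubles the value there.\<close>

lemma cos_dual_orthogonality:
  assumes n: "n \<ge> 1" and a: "a \<le> n" and i: "i \<le> n"
  shows "(\<Sum>\<gamma>\<le>n. end_wt n \<gamma> * (cos (real \<gamma> * real a * pi / real n) * cos (real \<gamma> * real i * pi / real n))) =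
    of_bool (a = i) * (2 * real n / end_wt n a)"
proof -
  let ?c = "\<lambda>m \<gamma>. cos (real \<gamma> * real m * pi / real n)"
  have c: "?c m (2 * n - \<gamma>) = ?c m \<gamma>" if "\<gamma> \<le> n" for m \<gamma>
    using cos_reflect[of n \<gamma> "int m"] that n by (simp add: mult_ac)
  define d s where "d = int a - int i" and "s = int a + int i"
  have "(\<Sum>\<gamma>\<le>n. end_wt n \<gamma> * (?c a \<gamma> * ?c i \<gamma>)) = (\<Sum>\<gamma><2 * n. ?c a \<gamma> * ?c i \<gamma>)"
    by (rule sum_end_wt_fold[OF n]) (simp only: c)
  \<comment> \<open>The summand \<open>0\<close> is the phase in \<open>sum_cos_equidistant\<close>,
    applied with \<open>2 * n\<close> points.\<close>
  also have "\<dots> = (\<Sum>\<gamma><2 * n. (cos (0 + 2 * pi * of_int d * real \<gamma> / real (2 * n)) +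
      cos (0 + 2 * pi * of_int s * real \<gamma> / real (2 * n))) / 2)"
    by (simp add: d_def s_def cos_times_cos diff_divide_distrib add_divide_distrib algebra_simps)
  also have "\<dots> = ((\<Sum>\<gamma><2 * n. cos (0 + 2 * pi * of_int d * real \<gamma> / real (2 * n))) +
      (\<Sum>\<gamma><2 * n. cos (0 + 2 * pi * of_int s * real \<gamma> / real (2 * n)))) / 2"
    by (simp only: sum_divide_distrib[symmetric] sum.distrib)
  also have "\<dots> = ((if int (2 * n) dvd d then real (2 * n) * cos 0 else 0) +
      (if int (2 * n) dvd s then real (2 * n) * cos 0 else 0)) / 2"
    using n by (subst (1 2) sum_cos_equidistant) auto
  also have "int (2 * n) dvd d \<longleftrightarrow> a = i"
    using n a i dvd_imp_le_int[of d "int (2 * n)"] by (cases "d = 0") (auto simp: d_def)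
  also have "int (2 * n) dvd s \<longleftrightarrow> a = i \<and> (a = 0 \<or> a = n)"
    using n a i dvd_imp_le_int[of s "int (2 * n)"] by (cases "s = 0") (auto simp: s_def)
  finally show ?thesis using n a by (auto simp: end_wt_def)
qed

text \<open>The coefficients of the point mass at \<open>a\<close> in the one-dimensional cosine system.\<close>

definition delta_coeff :: "nat \<Rightarrow> nat \<Rightarrow> nat \<Rightarrow> real" where
  "delta_coeff n a \<gamma> = end_wt n a * end_wt n \<gamma> * cos (real \<gamma> * real a * pi / real n) / (2 * real n)"

lemma sum_delta_coeff:
  assumes n: "n \<ge> 1" and a: "a \<le> n" and i: "i \<le> n"
  shows "(\<Sum>\<gamma>\<le>n. delta_coeff n a \<gamma> * cos (real \<gamma> * real i * pi / real n)) = of_bool (a = i)"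
proof -
  have "(\<Sum>\<gamma>\<le>n. delta_coeff n a \<gamma> * cos (real \<gamma> * real i * pi / real n)) =
    end_wt n a / (2 * real n) * (\<Sum>\<gamma>\<le>n. end_wt n \<gamma> * (cos (real \<gamma> * real a * pi / real n) * cos (real \<gamma> * real i * pi / real n)))"
    by (simp add: delta_coeff_def sum_distrib_left mult_ac)
  also have "\<dots> = of_bool (a = i)"
    using n unfolding cos_dual_orthogonality[OF n a i] by (simp add: end_wt_def)
  finally show ?thesis .
qed

lemma sum_fun_apply: "(\<Sum>k\<in>K. f k) x = (\<Sum>k\<in>K. f k x :: complex)"
  by (induction K rule: infinite_finite_induct) auto

text \<open>The coefficients \<open>C a\<close> are products of one-dimensional ones and yield the
  point mass at \<open>a\<close>; \<open>f\<close> is the sum of these point masses weighted by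
  \<open>f a\<close>.\<close>

lemma fun_space_subset_span_chi_box:
  assumes n: "\<And>j. j \<in> {1..d} \<Longrightarrow> n j \<ge> 1"
  shows "fun_space (LC_index d n) \<subseteq> cfun.span (LC_chi d n ` (\<Pi>\<^sub>E j\<in>{1..d}. {..n j}))"
    (is "_ \<subseteq> cfun.span (_ ` ?B)")
proof
  fix f :: "(nat \<Rightarrow> nat) \<Rightarrow> complex"
  assume f: "f \<in> fun_space (LC_index d n)"
  define C where "C a \<gamma> = (\<Prod>j\<in>{1..d}. delta_coeff (n j) (a j) (\<gamma> j))" for a \<gamma>
  have delta: "(\<Sum>\<gamma>\<in>?B. C a \<gamma> * cos_prod d n \<gamma> x) = of_bool (a = x)"
    if a: "a \<in> LC_index d n" and x: "x \<in> LC_index d n" for a x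
  proof -
    have le: "a j \<le> n j" "x j \<le> n j" if "j \<in> {1..d}" for j
      using a x that by (auto simp: LC_index_def LC_parity_def)
    have ext: "a \<in> extensional {1..d}" "x \<in> extensional {1..d}"
      using a x by (auto simp: LC_index_def LC_parity_def)
    have "(\<Sum>\<gamma>\<in>?B. C a \<gamma> * cos_prod d n \<gamma> x) = (\<Sum>\<gamma>\<in>?B. \<Prod>j\<in>{1..d}.
        delta_coeff (n j) (a j) (\<gamma> j) * cos (real (\<gamma> j) * real (x j) * pi / real (n j)))"
      by (simp add: C_def cos_prod_def prod.distrib)
    also have "\<dots> = (\<Prod>j\<in>{1..d}. \<Sum>\<gamma>\<le>n j. delta_coeff (n j) (a j) \<gamma> * cos (real \<gamma> * real (x j) * pi / real (n j)))"
      by (rule prod_sum_PiE[symmetric]) auto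
    also have "\<dots> = (\<Prod>j\<in>{1..d}. of_bool (a j = x j))"
      using n le by (intro prod.cong refl sum_delta_coeff)
    also have "\<dots> = of_bool (a = x)"
    proof (cases "a = x")
      case False
      then obtain j where "j \<in> {1..d}" "a j \<noteq> x j" using ext by (meson extensionalityI)
      then have "(\<Prod>j\<in>{1..d}. of_bool (a j = x j)) = (0 :: real)" by (intro prod_zero) auto
      with False show ?thesis by simp
    qed simp
    finally show ?thesis .
  qed
  have "f = (\<Sum>a\<in>LC_index d n. \<Sum>\<gamma>\<in>?B. (\<lambda>x. (f a * of_real (C a \<gamma>)) * LC_chi d n \<gamma> x))"
  proof
    fix x
    show "f x = (\<Sum>a\<in>LC_index d n. \<Sum>\<gamma>\<in>?B. (\<lambda>x. (f a * of_real (C a \<gamma>)) * LC_chi d n \<gamma> x)) x"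
    proof (cases "x \<in> LC_index d n")
      case True
      have "(\<Sum>\<gamma>\<in>?B. (f a * of_real (C a \<gamma>)) * LC_chi d n \<gamma> x) = f a * of_bool (a = x)"
        if a: "a \<in> LC_index d n" for a
      proof -
        have "(\<Sum>\<gamma>\<in>?B. (f a * of_real (C a \<gamma>)) * LC_chi d n \<gamma> x) =
          f a * of_real (\<Sum>\<gamma>\<in>?B. C a \<gamma> * cos_prod d n \<gamma> x)"
          by (simp add: LC_chi_eq_cos_prod[OF True] sum_distrib_left mult_ac)
        also have "\<dots> = f a * of_bool (a = x)"
          by (subst delta[OF a True]) simp
        finally show ?thesis .
      qed
      then have "(\<Sum>a\<in>LC_index d n. \<Sum>\<gamma>\<in>?B. (f a * of_real (C a \<gamma>)) * LC_chi d n \<gamma> x) =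
          (\<Sum>a\<in>LC_index d n. if a = x then f a else 0)"
        by (intro sum.cong) auto
      with True show ?thesis by (simp add: sum_fun_apply finite_LC_index)
    next
      case False
      with f show ?thesis by (simp add: sum_fun_apply LC_chi_def fun_space_def)
    qed
  qed
  also have "\<dots> \<in> cfun.span (LC_chi d n ` ?B)"
    by (intro cfun.span_sum cfun.span_scale cfun.span_base imageI)
  finally show "f \<in> cfun.span (LC_chi d n ` ?B)" .
qed

section \<open>Reduction of the box to \<open>LC_Gamma\<close>\<close>

lemma cos_complement:
  assumes "n \<ge> 1" "g \<le> n"
  shows "cos (real (n - g) * real x * pi / real n) = (-1) ^ x * cos (real g * real x * pi / real n)"
proof -
  have "real (n - g) * real x * pi / real n = real x * pi - real g * real x * pi / real n"
    using assms by (simp add: of_nat_diff field_simps)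
  then show ?thesis by (simp add: cos_diff)
qed

lemma LC_chi_eqI:
  assumes "\<And>r x. r < 2 \<Longrightarrow> x \<in> LC_parity d n r \<Longrightarrow> cos_prod d n g x = cos_prod d n h x"
  shows "LC_chi d n g = LC_chi d n h"
proof
  fix x
  show "LC_chi d n g x = LC_chi d n h x"
  proof (cases "x \<in> LC_index d n")
    case True
    then have "cos_prod d n g x = cos_prod d n h x"
      using assms[of 0 x] assms[of 1 x] by (auto simp: LC_index_def)
    with True show ?thesis by (simp add: LC_chi_eq_cos_prod)
  qed (simp add: LC_chi_def)
qed

text \<open>The two flips produce the signs \<open>(-1) ^ x j\<close> and \<open>(-1) ^ x k\<close>,
  which agree because all entries of an index have the same parity.\<close>

lemma LC_chi_flip_pair:
  assumes jk: "j \<in> {1..d}" "k \<in> {1..d}" "j \<noteq> k" and n: "n j \<ge> 1" "n k \<ge> 1" and g: "g j \<le> n j" "g k \<le> n k"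
  shows "LC_chi d n (g(j := n j - g j, k := n k - g k)) = LC_chi d n g"
proof (rule LC_chi_eqI)
  fix r x assume x: "x \<in> LC_parity d n r"
  let ?h = "g(j := n j - g j, k := n k - g k)"
  let ?c = "\<lambda>g l. cos (real (g l) * real (x l) * pi / real (n l))"
  have split: "cos_prod d n h x = ?c h j * (?c h k * (\<Prod>l\<in>{1..d} - {j} - {k}. ?c h l))" for h
    unfolding cos_prod_def using jk
    by (subst prod.remove[of _ j], simp, simp, subst prod.remove[of _ k]) auto
  have "even (x j) \<longleftrightarrow> even (x k)"
    using x jk by (auto simp: LC_parity_def even_iff_mod_2_eq_zero)
  then have sgn: "(-1) ^ x j * (-1) ^ x k = (1 :: real)"
    by (auto simp: minus_one_power_iff)
  have "(\<Prod>l\<in>{1..d} - {j} - {k}. ?c ?h l) = (\<Prod>l\<in>{1..d} - {j} - {k}. ?c g l)"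
    by (rule prod.cong) auto
  moreover have "?c ?h j = (-1) ^ x j * ?c g j" "?c ?h k = (-1) ^ x k * ?c g k"
    using jk n g by (simp_all only: fun_upd_def cos_complement if_True if_False simp_thms)
  ultimately have "cos_prod d n ?h x = ((-1) ^ x j * (-1) ^ x k) * cos_prod d n g x"
    unfolding split by (simp only: mult_ac)
  then show "cos_prod d n ?h x = cos_prod d n g x" by (simp add: sgn)
qed

lemma LC_chi_reduce:
  assumes d: "d \<ge> 1" and n: "\<And>j. j \<in> {1..d} \<Longrightarrow> n j \<ge> 1"
    and cop: "\<And>i j. i \<in> {1..d} \<Longrightarrow> j \<in> {1..d} \<Longrightarrow> i \<noteq> j \<Longrightarrow> coprime (n i) (n j)"
    and g0: "g0 \<in> (\<Pi>\<^sub>E j\<in>{1..d}. {..n j})"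
  shows "LC_chi d n g0 \<in> LC_chi d n ` LC_Gamma d n"
proof -
  let ?B = "\<Pi>\<^sub>E j\<in>{1..d}. {..n j}"
  let ?S = "{g \<in> ?B. LC_chi d n g = LC_chi d n g0}"
  let ?m = "\<lambda>g. \<Sum>j\<in>{1..d}. real (g j) / real (n j)"
  have "finite ?S" by (rule finite_subset[of _ ?B]) (auto intro: finite_PiE)
  moreover have "?S \<noteq> {}" using g0 by auto
  ultimately obtain g where "is_arg_min ?m (\<lambda>g. g \<in> ?S) g"
    using ex_is_arg_min_if_finite[of ?S ?m] by blast
  then have g: "g \<in> ?B" "LC_chi d n g = LC_chi d n g0" and min: "\<And>h. h \<in> ?S \<Longrightarrow> ?m g \<le> ?m h"
    by (auto simp: is_arg_min_linorder)
  have le: "g j \<le> n j" if "j \<in> {1..d}" for j using g(1) that by auto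
  have pair: "real (g j) / real (n j) + real (g k) / real (n k) \<le> 1"
    if jk: "j \<in> {1..d}" "k \<in> {1..d}" "j \<noteq> k" for j k
  proof -
    let ?h = "g(j := n j - g j, k := n k - g k)"
    have "?h \<in> ?B" using g(1) jk by (auto simp: PiE_iff extensional_def)
    moreover have "LC_chi d n ?h = LC_chi d n g0"
      using LC_chi_flip_pair[of j d k n g] jk n le g(2) by simp
    ultimately have m: "?m g \<le> ?m ?h" using min[of ?h] by blast
    have split: "?m h = real (h j) / real (n j) + (real (h k) / real (n k) +
        (\<Sum>l\<in>{1..d} - {j} - {k}. real (h l) / real (n l)))" for h
      using jk by (subst sum.remove[of _ j], simp, simp, subst sum.remove[of _ k]) auto
    have "(\<Sum>l\<in>{1..d} - {j} - {k}. real (?h l) / real (n l)) =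
        (\<Sum>l\<in>{1..d} - {j} - {k}. real (g l) / real (n l))"
      by (rule sum.cong) auto
    moreover have "real (?h j) / real (n j) = 1 - real (g j) / real (n j)"
      "real (?h k) / real (n k) = 1 - real (g k) / real (n k)"
      using jk n[OF jk(1)] n[OF jk(2)] le[OF jk(1)] le[OF jk(2)] by (simp_all add: of_nat_diff diff_divide_distrib)
    \<comment> \<open>The flip turns the sum \<open>s\<close> of the two fractions into
      \<open>2 - s\<close>, so minimality gives \<open>s \<le> 2 - s\<close>.\<close>
    ultimately show ?thesis using m unfolding split[of g] split[of ?h] by linarith
  qed
  show ?thesis
  proof (cases "\<exists>k\<in>{1..d}. g k = n k")
    case True
    then obtain k where k: "k \<in> {1..d}" "g k = n k" by auto
    have 0: "g j = 0" if "j \<in> {1..d}" "j \<noteq> k" for j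
      using pair[OF that(1) k(1) that(2)] n[OF k(1)] n[OF that(1)] k(2) by (auto simp: divide_le_0_iff)
    have "LC_chi d n g = LC_chi d n (last_tuple d n)"
    proof (rule LC_chi_eqI)
      fix r x assume x: "x \<in> LC_parity d n r"
      have "cos_prod d n g x = (-1) ^ r"
        using x k(1) n[OF k(1)] k(2) 0 by (rule cos_prod_single_top)
      also have "\<dots> = cos_prod d n (last_tuple d n) x"
        using d n[of d] x by (simp add: cos_prod_last_tuple)
      finally show "cos_prod d n g x = cos_prod d n (last_tuple d n) x" .
    qed
    then show ?thesis unfolding g(2)[symmetric] LC_Gamma_eq by simp
  next
    case False
    with le have lt: "g j < n j" if "j \<in> {1..d}" for j using that le_neq_implies_less by blast
    have "real (g j) / real (n j) + real (g k) / real (n k) \<noteq> 1"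
      if jk: "j \<in> {1..d}" "k \<in> {1..d}" "j \<noteq> k" for j k
    proof
      assume eq: "real (g j) / real (n j) + real (g k) / real (n k) = 1"
      have pos: "n j \<ge> 1" "n k \<ge> 1" using n jk by auto
      then have "real (g j * n k + g k * n j) = real (n j * n k)"
        using eq by (simp add: field_simps)
      then have nat_eq: "g j * n k + g k * n j = n j * n k" by (simp only: of_nat_eq_iff)
      \<comment> \<open>Coprimality turns this into \<open>n j dvd g j\<close>, so
        \<open>g j = 0\<close>; the equation then forces the excluded case
        \<open>g k = n k\<close>.\<close>
      then have "n j dvd g j * n k" by (metis dvd_add_left_iff dvd_triv_left dvd_triv_right)
      then have "n j dvd g j" using cop[OF jk] by (simp add: coprime_dvd_mult_left_iff)
      then have "g j = 0" using lt[OF jk(1)] by (auto dest: dvd_imp_le)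
      then have "g k = n k" using nat_eq pos by auto
      then show False using lt[OF jk(2)] by simp
    qed
    then have "g \<in> LC_Gamma_strict d n"
      using g(1) lt pair by (auto simp: LC_Gamma_strict_def PiE_iff less_le)
    then show ?thesis unfolding g(2)[symmetric] LC_Gamma_eq by simp
  qed
qed

theorem theorem2p7:
  fixes d :: nat and n :: "nat \<Rightarrow> nat"
  assumes "d \<ge> 1"
    and "\<And>j. j \<in> {1..d} \<Longrightarrow> n j \<ge> 1"
    and "\<And>i j. i \<in> {1..d} \<Longrightarrow> j \<in> {1..d} \<Longrightarrow> i \<noteq> j \<Longrightarrow> coprime (n i) (n j)"
  shows "orthogonal_basis (fun_space (LC_index d n)) (LC_inner d n) (LC_chi d n) (LC_Gamma d n)
    \<and> (\<forall>\<gamma> \<in> LC_Gamma d n - {last_tuple d n}. (LC_norm d n (LC_chi d n \<gamma>))\<^sup>2 = 1 / 2 ^ num_pos d \<gamma>)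
    \<and> (LC_norm d n (LC_chi d n (last_tuple d n)))\<^sup>2 = 1"
proof -
  let ?\<chi> = "LC_chi d n"
  have last: "LC_inner d n (?\<chi> g) (?\<chi> (last_tuple d n)) = 0"
    "LC_inner d n (?\<chi> (last_tuple d n)) (?\<chi> g) = 0" if "g \<in> LC_Gamma_strict d n" for g
    using LC_inner_strict_last[OF assms(1,2) that] LC_inner_commute[of d n "?\<chi> (last_tuple d n)" "?\<chi> g"]
    by simp_all
  have orth: "LC_inner d n (?\<chi> g) (?\<chi> h) = 0"
    if "g \<in> LC_Gamma d n" "h \<in> LC_Gamma d n" "g \<noteq> h" for g h
    using that last LC_inner_strict_orthogonal[OF assms(1)] by (auto simp: LC_Gamma_eq)
  have self: "LC_inner d n (?\<chi> g) (?\<chi> g) \<noteq> 0" if "g \<in> LC_Gamma d n" for g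
    using that LC_inner_last_last[OF assms(1,2)] LC_inner_strict_self[OF assms(1)]
    by (auto simp: LC_Gamma_eq)
  have "cfun.span (?\<chi> ` LC_Gamma d n) = fun_space (LC_index d n)"
  proof
    show "cfun.span (?\<chi> ` LC_Gamma d n) \<subseteq> fun_space (LC_index d n)"
      by (rule cfun.span_minimal) (auto simp: LC_chi_in_fun_space subspace_fun_space)
    \<comment> \<open>Restricting the box to \<open>LC_Gamma\<close> loses no functions, so the span
      stays the same.\<close>
    have "?\<chi> ` (\<Pi>\<^sub>E j\<in>{1..d}. {..n j}) \<subseteq> ?\<chi> ` LC_Gamma d n"
      by (intro image_subsetI LC_chi_reduce assms)
    then show "fun_space (LC_index d n) \<subseteq> cfun.span (?\<chi> ` LC_Gamma d n)"
      by (intro order_trans[OF fun_space_subset_span_chi_box cfun.span_mono] assms(2))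
  qed
  then have "orthogonal_basis (fun_space (LC_index d n)) (LC_inner d n) ?\<chi> (LC_Gamma d n)"
    unfolding orthogonal_basis_def
    by (intro conjI ballI impI LC_orthogonal_independent[of _ d n] orth self)
  moreover have "(LC_norm d n (?\<chi> g))\<^sup>2 = 1 / 2 ^ num_pos d g"
    if "g \<in> LC_Gamma d n - {last_tuple d n}" for g
  proof -
    have "g \<in> LC_Gamma_strict d n" using that by (auto simp: LC_Gamma_eq)
    then show ?thesis by (simp add: LC_norm_def LC_inner_strict_self[OF assms(1)] del: of_real_divide)
  qed
  moreover have "(LC_norm d n (?\<chi> (last_tuple d n)))\<^sup>2 = 1"
    using LC_inner_last_last[OF assms(1,2)] by (simp add: LC_norm_def)
  ultimately show ?thesis by blast
qed

end
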